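(* Consider an $N$-player game ($N\ge2$) with cost functions $f_i:\mathbb{R}^N\to\mathbb{R}$, $i\in\mathbb{N}=\{1,\dots,N\}$, and player dynamics $\dot x_i=v_i$, $\dot v_i=u_i$ with $x_i,v_i,u_i\in\mathbb{R}$, where the players communicate over an undirected and connected graph $\mathcal{G}$ with node set $\mathbb{N}$, adjacency matrix $[a_{ij}]$ and Laplacian $\mathcal{L}$. Suppose that: (1) each $f_i$ is twice continuously differentiable; (2) there is a constant $m>0$ with $(\mathbf{x}-\mathbf{y})^T(\mathcal{P}(\mathbf{x})-\mathcal{P}(\mathbf{y}))\ge m\|\mathbf{x}-\mathbf{y}\|^2$ for all $\mathbf{x},\mathbf{y}\in\mathbb{R}^N$; (3) there is a constant $h>0$ with $\sup_{\mathbf{x}\in\mathbb{R}^N}\|H(\mathbf{x})\|=h$. Let each player $i\in\mathbb{N}$ use the distributed filter-based control $$u_i=-k_1\frac{\partial f_i}{\partial x_i}(\mathbf{z}_i)-k_1y_i,\qquad y_i=-\hat x_i+k_2x_i,\qquad \dot{\hat x}_i=-k_2\hat x_i+k_2^2x_i,$$ $$\dot z_{ij}=-k_3\left(\sum_{k=1}^Na_{ik}(z_{ij}-z_{kj})+a_{ij}(z_{ij}-x_j)\right),\quad j\in\mathbb{N},$$ where $\mathbf{z}_i=[z_{i1},\dots,z_{iN}]^T$ and $k_1,k_2,k_3$ are positive constants satisfying $$k_1>\frac{\left(h\sqrt{N}\max_{i\in\mathbb{N}}\{l_i\}+1\right)^2}{4m}+h,\qquad k_2>k_1,$$ $$k_3>\frac{\left(2k_1\max_{i\in\mathbb{N}}\{l_i\}+\sqrt{N}+N\max_{i\in\mathbb{N}}\{l_i\}\right)^2}{4\min\{\lambda_{min}(A),k_2-k_1\}\,\lambda_{min}(\mathcal{L}\otimes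 I_{N\times N}+A_0)},$$ with $$A=\begin{bmatrix} m & -\frac{h\sqrt{N}\max_{i\in\mathbb{N}}\{l_i\}+1}{2}\\ -\frac{h\sqrt{N}\max_{i\in\mathbb{N}}\{l_i\}+1}{2} & k_1-h\end{bmatrix}.$$ Then distributed Nash equilibrium seeking is achieved, i.e., under this strategy, in which each player uses only its own information and that of its neighbors, for every initial condition of the closed-loop system, $$\lim_{t\to\infty}\|\mathbf{x}(t)-\mathbf{x}^*\|=0,\qquad \lim_{t\to\infty}\|\mathbf{v}(t)\|=0,$$ where $\mathbf{x}^*$ is the Nash equilibrium of the game.
   Context: Notation: $\mathbf{x}=[x_1,\dots,x_N]^T$, $\mathbf{v}=[v_1,\dots,v_N]^T$, $\mathbf{x}_{-i}$ is $\mathbf{x}$ with the entry $x_i$ removed, and $f_i(\mathbf{x})=f_i(x_i,\mathbf{x}_{-i})$. $\|\cdot\|$ is the Euclidean norm for vectors and the induced norm for matrices. $\mathcal{P}(\mathbf{x})=\left[\frac{\partial f_1(\mathbf{x})}{\partial x_1},\dots,\frac{\partial f_N(\mathbf{x})}{\partial x_N}\right]^T$, and $H(\mathbf{x})$ is the $N\times N$ matrix whose $(i,j)$ entry is $\frac{\partial^2 f_i(\mathbf{x})}{\partial x_i\partial x_j}$. $\frac{\partial f_i}{\partial x_i}(\mathbf{z}_i)=\frac{\partial f_i(\mathbf{x})}{\partial x_i}\big|_{\mathbf{x}=\mathbf{z}_i}$. A Nash equilibrium is a profile $\mathbf{x}^*=(x_i^*,\mathbf{x}_{-i}^* )$ with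 $f_i(x_i^*,\mathbf{x}_{-i}^* )\le f_i(x_i,\mathbf{x}_{-i}^* )$ for all $x_i\in\mathbb{R}$, $i\in\mathbb{N}$. Under hypotheses (1)-(2) the Nash equilibrium is unique, and $\mathcal{P}(\mathbf{x}^* )=\mathbf{0}$. By (3), each $\frac{\partial f_i}{\partial x_i}$ is globally Lipschitz on $\mathbb{R}^N$; $l_i$ denotes its Lipschitz constant: $\left|\frac{\partial f_i}{\partial x_i}(\mathbf{x})-\frac{\partial f_i}{\partial x_i}(\mathbf{y})\right|\le l_i\|\mathbf{x}-\mathbf{y}\|$ for all $\mathbf{x},\mathbf{y}\in\mathbb{R}^N$. Graph: $\mathcal{G}=(\mathbb{N},\mathcal{E})$ is undirected; $a_{ij}=1$ if $(j,i)\in\mathcal{E}$, $a_{ij}=0$ otherwise, and $a_{ii}=0$. $\mathcal{L}=\mathcal{D}-\mathcal{A}$ with $\mathcal{A}=[a_{ij}]$ and $\mathcal{D}$ diagonal with $i$th diagonal entry $\sum_{j=1}^Na_{ij}$. $A_0$ is the $N^2\times N^2$ diagonal matrix with diagonal entries $a_{11},a_{12},\dots,a_{1N},a_{21},\dots,a_{NN}$, successively. $I_{N\times N}$ is the identity matrix, $\otimes$ the Kronecker product, and $\lambda_{min}(\Gamma)$ the minimum eigenvalue of a symmetric real matrix $\Gamma$. Since $\mathcal{G}$ is undirected and connected, $\lambda_{min}(\mathcal{L}\otimes I_{N\times N}+A_0)>0$. In the strategy, $\hat x_i\in\mathbb{R}$ is an auxiliary variable, $y_i\in\mathbb{R}$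 serves as an estimate of $v_i$, and $\mathbf{z}_i\in\mathbb{R}^N$ is player $i$'s estimate of $\mathbf{x}$. *)

theory Defs
  imports "HOL-Analysis.Analysis"
begin

definition replace_coord :: "real^'n \<Rightarrow> 'n::finite \<Rightarrow> real \<Rightarrow> real^'n" where
  "replace_coord x i s = (\<chi> j. if j = i then s else x $ j)"

definition partial_deriv :: "'n::finite \<Rightarrow> (real^'n \<Rightarrow> real) \<Rightarrow> real^'n \<Rightarrow> real" where
  "partial_deriv i g x = deriv (\<lambda>s. g (replace_coord x i s)) (x $ i)"

definition twice_continuously_differentiable :: "('a::real_normed_vector \<Rightarrow> real) \<Rightarrow> bool" where
  "twice_continuously_differentiable g \<longleftrightarrow>
     (\<exists>(g' :: 'a \<Rightarrow> 'a \<Rightarrow>\<^sub>L real) (g'' :: 'a \<Rightarrow> 'a \<Rightarrow>\<^sub>L 'a \<Rightarrow>\<^sub>L real).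
        (\<forall>x. (g has_derivative blinfun_apply (g' x)) (at x)) \<and>
        (\<forall>x. (g' has_derivative blinfun_apply (g'' x)) (at x)) \<and>
        continuous_on UNIV g'')"

definition pseudo_gradient :: "('n::finite \<Rightarrow> real^'n \<Rightarrow> real) \<Rightarrow> real^'n \<Rightarrow> real^'n" where
  "pseudo_gradient f x = (\<chi> i. partial_deriv i (f i) x)"

definition game_hessian :: "('n::finite \<Rightarrow> real^'n \<Rightarrow> real) \<Rightarrow> real^'n \<Rightarrow> real^'n^'n" where
  "game_hessian f x = (\<chi> i j. partial_deriv i (partial_deriv j (f i)) x)"

definition nash_equilibrium :: "('n::finite \<Rightarrow> real^'n \<Rightarrow> real) \<Rightarrow> real^'n \<Rightarrow> bool" where
  "nash_equilibrium f x \<longleftrightarrow> (\<forall>i s. f i x \<le> f i (replace_coord x i s))"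

text \<open>The node set of a graph is the whole (finite) index type; a graph is given by its edge set.\<close>

definition undirected_graph :: "('n \<times> 'n) set \<Rightarrow> bool" where
  "undirected_graph E \<longleftrightarrow> sym E \<and> irrefl E"

definition connected_graph :: "('n \<times> 'n) set \<Rightarrow> bool" where
  "connected_graph E \<longleftrightarrow> (\<forall>i j. (i, j) \<in> E\<^sup>*)"

definition adjacency :: "('n::finite \<times> 'n) set \<Rightarrow> real^'n^'n" where
  "adjacency E = (\<chi> i j. if (j, i) \<in> E then 1 else 0)"

definition laplacian :: "('n::finite \<times> 'n) set \<Rightarrow> real^'n^'n" where
  "laplacian E =
     (\<chi> i j. if i = j then (\<Sum>k\<in>UNIV. adjacency E $ i $ k) else 0) - adjacency E"

text \<open>Matrices of size \<open>N\<^sup>2 \<times> N\<^sup>2\<close> are indexed by pairs: the pair \<open>(i, j)\<close> stands for the position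
  \<open>(i - 1) N + j\<close>.\<close>

definition kronecker_product :: "real^'a::finite^'b::finite \<Rightarrow> real^'c::finite^'d::finite \<Rightarrow> real^('a \<times> 'c)^('b \<times> 'd)" where
  "kronecker_product A B = (\<chi> p q. A $ fst p $ fst q * B $ snd p $ snd q)"

definition adjacency_diag :: "('n::finite \<times> 'n) set \<Rightarrow> real^('n \<times> 'n)^('n \<times> 'n)" where
  "adjacency_diag E = (\<chi> p q. if p = q then adjacency E $ fst p $ snd p else 0)"

text \<open>\<open>Min\<close> is meaningful here because a symmetric real matrix has a finite and nonempty set of
  real eigenvalues; \<open>min_eigenvalue\<close> is applied to symmetric matrices only.\<close>

definition eigenvalue :: "real^'n^'n \<Rightarrow> real \<Rightarrow> bool" where
  "eigenvalue M c \<longleftrightarrow> (\<exists>v. v \<noteq> 0 \<and> M *v v = c *\<^sub>R v)"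

definition min_eigenvalue :: "real^'n^'n \<Rightarrow> real" where
  "min_eigenvalue M = Min {c. eigenvalue M c}"

definition gain_matrix :: "real \<Rightarrow> real \<Rightarrow> real \<Rightarrow> real^2^2" where
  "gain_matrix m b c = vector [vector [m, - b / 2], vector [- b / 2, c]]"

text \<open>A trajectory of the closed-loop system on the time interval \<open>[0, \<infinity>)\<close>; the initial condition
  is its (unrestricted) value at time \<open>0\<close>. Row \<open>i\<close> of \<open>z t\<close> is player \<open>i\<close>'s estimate of \<open>x t\<close>.\<close>

definition closed_loop_trajectory ::
  "('n::finite \<Rightarrow> real^'n \<Rightarrow> real) \<Rightarrow> ('n \<times> 'n) set \<Rightarrow> real \<Rightarrow> real \<Rightarrow> real \<Rightarrow>
   (real \<Rightarrow> real^'n) \<Rightarrow> (real \<Rightarrow> real^'n) \<Rightarrow> (real \<Rightarrow> real^'n) \<Rightarrow> (real \<Rightarrow> real^'n^'n) \<Rightarrow> bool" where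
  "closed_loop_trajectory f E k1 k2 k3 x v xhat z \<longleftrightarrow>
     (let a = (\<lambda>i j. adjacency E $ i $ j);
          y = (\<lambda>t i. - (xhat t $ i) + k2 * x t $ i);
          u = (\<lambda>t i. - k1 * partial_deriv i (f i) (z t $ i) - k1 * y t i)
      in \<forall>t\<ge>0. \<forall>i.
           ((\<lambda>s. x s $ i) has_real_derivative v t $ i) (at t within {0..}) \<and>
           ((\<lambda>s. v s $ i) has_real_derivative u t i) (at t within {0..}) \<and>
           ((\<lambda>s. xhat s $ i) has_real_derivative (- k2 * xhat t $ i + k2\<^sup>2 * x t $ i))
             (at t within {0..}) \<and>
           (\<forall>j. ((\<lambda>s. z s $ i $ j) has_real_derivative
              - k3 * ((\<Sum>k\<in>UNIV. a i k * (z t $ i $ j - z t $ k $ j))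
                      + a i j * (z t $ i $ j - x t $ j)))
             (at t within {0..})))"

end

theory Submission
  imports Defs
begin

text \<open>
  The proof is a Lyapunov argument. Write \<open>P\<close> for the pseudo-gradient, \<open>s = \<surd>N\<close>, and \<open>L\<close> for the
  largest Lipschitz constant. The closed loop is measured by four errors:
  \<open>e = x - x*\<close>, the distance to the equilibrium; \<open>w = v + P(x)\<close>, the deviation from the
  gradient play \<open>x' = - P(x)\<close>; \<open>q = y - v\<close>, the error of the filter as an estimate of the velocity;
  and \<open>\<xi> = z - 1 \<otimes> x\<close>, the error of the players' estimates of \<open>x\<close>. Since \<open>y' = k\<^sub>2 (v - y)\<close>, they obey

  \<^item> \<open>e' = w - P(x)\<close>,
  \<^item> \<open>w' = H(x) v - k\<^sub>1 (w + q + \<delta>)\<close>, where \<open>\<delta>\<close> is the change of the players' partial derivatives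
    caused by evaluating them at the rows of \<open>z\<close> instead of at \<open>x\<close>,
  \<^item> \<open>q' = - k\<^sub>2 q + k\<^sub>1 (w + q + \<delta>)\<close>,
  \<^item> \<open>\<xi>' = - k\<^sub>3 (\<L> \<otimes> I + A\<^sub>0) \<xi> - 1 \<otimes> v\<close>.

  For \<open>V = (\<parallel>e\<parallel>\<^sup>2 + \<parallel>w\<parallel>\<^sup>2 + \<parallel>q\<parallel>\<^sup>2 + \<parallel>\<xi>\<parallel>\<^sup>2) / 2\<close> the cross terms \<open>k\<^sub>1 (w \<bullet> q)\<close> cancel. Strong monotonicity,
  \<open>\<parallel>H\<parallel> \<le> h\<close>, \<open>\<parallel>P(x)\<parallel> \<le> s L \<parallel>e\<parallel>\<close>, \<open>\<parallel>\<delta>\<parallel> \<le> L \<parallel>\<xi>\<parallel>\<close> and the spectral bound for the grounded Laplacian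
  then estimate \<open>V'\<close> from above by a quadratic form in the four norms (\<open>dissipation_vector\<close>). The bound
  on \<open>k\<^sub>1\<close> and \<open>k\<^sub>2 > k\<^sub>1\<close> make the part in \<open>e\<close>, \<open>w\<close>, \<open>q\<close> negative definite, and the bound on \<open>k\<^sub>3\<close> is the
  discriminant condition under which the coupling to \<open>\<xi>\<close> preserves this
  (\<open>dissipation_scalar\<close>, \<open>gain_matrix_min_eigenvalue_pos\<close>). Hence \<open>V' \<le> - 2 c V\<close> with \<open>c > 0\<close>, and \<open>V\<close>
  decays exponentially. So \<open>e\<close> and \<open>w\<close> tend to zero, and with them \<open>v = w - P(x)\<close>.

  Three facts support this: the smallest eigenvalue of a symmetric matrix is the minimum of its
  Rayleigh quotient (\<open>symmetric_matrix_min_eigenvalue\<close>), the grounded Laplacian of a connected graph is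
  positive definite (\<open>grounded_laplacian_pos\<close>), and the Hessian of the game is the Jacobian of \<open>P\<close>
  (\<open>pseudo_gradient_has_derivative\<close>).
\<close>

section \<open>Extremal eigenvalues of symmetric matrices\<close>

text \<open>The first-order condition at a minimum of a quadratic polynomial, in the form needed to show that
  a minimiser of the Rayleigh quotient is an eigenvector.\<close>

lemma linear_term_zero_if_quadratic_nonneg:
  fixes a b :: real
  assumes "\<And>t. 0 \<le> 2 * t * a + t\<^sup>2 * b"
  shows "a = 0"
proof (rule ccontr)
  assume "a \<noteq> 0"
  define B where "B = \<bar>b\<bar> + 1"
  have B: "B > 0" "b < B" by (auto simp: B_def)
  have "0 \<le> (2 * (- a / B) * a + (- a / B)\<^sup>2 * b) * B\<^sup>2"
    using assms[of "- a / B"] by (intro mult_nonneg_nonneg) auto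
  also have "\<dots> = a\<^sup>2 * (b - 2 * B)"
    using B by (simp add: field_simps power2_eq_square)
  finally show False
    using \<open>a \<noteq> 0\<close> B by (simp add: zero_le_mult_iff)
qed

lemma symmetric_matrix_inner:
  fixes M :: "real^'n^'n"
  assumes "transpose M = M"
  shows "(M *v x) \<bullet> y = x \<bullet> (M *v y)"
  by (metis assms dot_lmul_matrix vector_transpose_matrix)

text \<open>Eigenvectors for distinct eigenvalues are orthogonal, hence independent. Finiteness is what gives
  the \<open>Min\<close> in \<^const>\<open>min_eigenvalue\<close> its meaning.\<close>

lemma finite_eigenvalues:
  fixes M :: "real^'n^'n"
  assumes sym: "transpose M = M"
  shows "finite {c. eigenvalue M c}"
proof -
  define S where "S = {c. eigenvalue M c}"
  have "\<forall>c\<in>S. \<exists>u. u \<noteq> 0 \<and> M *v u = c *\<^sub>R u"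
    by (auto simp: S_def eigenvalue_def)
  then obtain w where w: "\<And>c. c \<in> S \<Longrightarrow> w c \<noteq> 0 \<and> M *v w c = c *\<^sub>R w c"
    by metis
  have orth: "w c \<bullet> w d = 0" if "c \<in> S" "d \<in> S" "c \<noteq> d" for c d
  proof -
    have "c * (w c \<bullet> w d) = d * (w c \<bullet> w d)"
      using symmetric_matrix_inner[OF sym, of "w c" "w d"] w[OF that(1)] w[OF that(2)] by simp
    then show ?thesis using that(3) by simp
  qed
  have inj: "inj_on w S"
  proof (rule inj_onI)
    fix c d assume *: "c \<in> S" "d \<in> S" "w c = w d"
    then have "w c \<bullet> w d \<noteq> 0" using w by simp
    then show "c = d" using orth * by blast
  qed
  have "pairwise orthogonal (w ` S)" "0 \<notin> w ` S"
    using orth w by (auto simp: pairwise_def orthogonal_def)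
  then have "finite (w ` S)"
    using pairwise_orthogonal_independent independent_imp_finite by blast
  then show ?thesis
    using finite_imageD inj unfolding S_def by blast
qed

text \<open>The quadratic form attains its minimum \<open>c\<close> over the compact unit sphere at some \<open>u\<close>. Perturbing \<open>u\<close>
  in an arbitrary direction shows \<open>M u = c u\<close>, and \<open>c\<close> is below every other eigenvalue because it is
  below the form at each unit eigenvector.\<close>

lemma symmetric_matrix_min_eigenvalue:
  fixes M :: "real^'n^'n"
  assumes sym: "transpose M = M"
  shows "eigenvalue M (min_eigenvalue M)"
    and "min_eigenvalue M * (norm y)\<^sup>2 \<le> y \<bullet> (M *v y)"
proof -
  have "continuous_on (sphere 0 1) (\<lambda>u::real^'n. u \<bullet> (M *v u))"
    by (intro continuous_intros linear_continuous_on bounded_linear_intros)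
  moreover have "sphere (0::real^'n) 1 \<noteq> {}" by simp
  ultimately obtain u where u: "norm u = 1"
    and umin: "\<And>y. norm y = 1 \<Longrightarrow> u \<bullet> (M *v u) \<le> y \<bullet> (M *v y)"
    using continuous_attains_inf[OF compact_sphere, of 0 1] by fastforce
  define c where "c = u \<bullet> (M *v u)"
  have form: "c * (norm y)\<^sup>2 \<le> y \<bullet> (M *v y)" for y
  proof (cases "y = 0")
    case False
    have "c \<le> (y /\<^sub>R norm y) \<bullet> (M *v (y /\<^sub>R norm y))"
      unfolding c_def using False by (intro umin) simp
    also have "\<dots> = (y \<bullet> (M *v y)) / (norm y)\<^sup>2"
      by (simp add: matrix_vector_mult_scaleR field_simps power2_eq_square)
    finally show ?thesis using False by (simp add: field_simps)
  qed simp
  have ort: "y \<bullet> (M *v u - c *\<^sub>R u) = 0" for y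
  proof (rule linear_term_zero_if_quadratic_nonneg)
    fix t :: real
    let ?p = "u + t *\<^sub>R y"
    have "0 \<le> ?p \<bullet> (M *v ?p) - c * (?p \<bullet> ?p)"
      using form[of ?p] by (simp add: power2_norm_eq_inner)
    also have "\<dots> = (u \<bullet> (M *v u) - c * (u \<bullet> u)) + 2 * t * (y \<bullet> (M *v u - c *\<^sub>R u))
        + t\<^sup>2 * (y \<bullet> (M *v y) - c * (y \<bullet> y))"
      using symmetric_matrix_inner[OF sym, of u y]
      by (simp add: matrix_vector_right_distrib matrix_vector_mult_scaleR inner_add_left
          inner_add_right inner_diff_right inner_commute power2_eq_square algebra_simps)
    also have "u \<bullet> (M *v u) - c * (u \<bullet> u) = 0"
      using u by (simp add: c_def norm_eq_1)
    finally show "0 \<le> 2 * t * (y \<bullet> (M *v u - c *\<^sub>R u)) + t\<^sup>2 * (y \<bullet> (M *v y) - c * (y \<bullet> y))"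
      by simp
  qed
  have ev: "eigenvalue M c"
    unfolding eigenvalue_def
  proof (intro exI conjI)
    show "u \<noteq> 0" using u by auto
    show "M *v u = c *\<^sub>R u" using ort[of "M *v u - c *\<^sub>R u"] by simp
  qed
  have least: "c \<le> d" if d: "eigenvalue M d" for d
  proof -
    obtain y where y: "y \<noteq> 0" "M *v y = d *\<^sub>R y" using d by (auto simp: eigenvalue_def)
    have "c * (norm y)\<^sup>2 \<le> d * (norm y)\<^sup>2"
      using form[of y] y by (simp add: power2_norm_eq_inner)
    then show ?thesis using y(1) by simp
  qed
  have "min_eigenvalue M = c"
    unfolding min_eigenvalue_def
    by (rule Min_eqI) (use finite_eigenvalues[OF sym] ev least in auto)
  then show "eigenvalue M (min_eigenvalue M)"
    and "min_eigenvalue M * (norm y)\<^sup>2 \<le> y \<bullet> (M *v y)"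
    using ev form by auto
qed

lemma min_eigenvalue_pos:
  fixes M :: "real^'n^'n"
  assumes sym: "transpose M = M" and pos: "\<And>y. y \<noteq> 0 \<Longrightarrow> 0 < y \<bullet> (M *v y)"
  shows "0 < min_eigenvalue M"
proof -
  obtain u where u: "u \<noteq> 0" "M *v u = min_eigenvalue M *\<^sub>R u"
    using symmetric_matrix_min_eigenvalue(1)[OF sym] by (auto simp: eigenvalue_def)
  have "0 < min_eigenvalue M * (u \<bullet> u)" using pos[OF u(1)] u(2) by simp
  then show ?thesis using u(1) by (metis inner_gt_zero_iff zero_less_mult_pos2)
qed

section \<open>Binary quadratic forms\<close>

lemma gain_matrix_form:
  "y \<bullet> (gain_matrix a b c *v y) = a * (y$1)\<^sup>2 - b * y$1 * y$2 + c * (y$2)\<^sup>2"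
proof -
  have "y \<bullet> (gain_matrix a b c *v y)
      = y$1 * (a * y$1 + (- b / 2) * y$2) + y$2 * ((- b / 2) * y$1 + c * y$2)"
    unfolding gain_matrix_def inner_vec_def matrix_vector_mult_def sum_2
    by simp
  then show ?thesis by algebra
qed

lemma gain_matrix_symmetric: "transpose (gain_matrix a b c) = gain_matrix a b c"
  by (simp add: gain_matrix_def transpose_def vec_eq_iff forall_2)

text \<open>The gain matrix serves twice: for the pair \<open>(\<parallel>x - x*\<parallel>, \<parallel>w\<parallel>)\<close>, as in the hypotheses on the
  gains, and for the coupling of the players' errors with the estimation errors.\<close>

lemma gain_matrix_lower_bound:
  "min_eigenvalue (gain_matrix a b c) * (s\<^sup>2 + t\<^sup>2) \<le> a * s\<^sup>2 - b * s * t + c * t\<^sup>2"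
  using symmetric_matrix_min_eigenvalue(2)[OF gain_matrix_symmetric, of a b c "vector [s, t]"]
  by (simp add: gain_matrix_form norm_vec_def L2_set_def sum_2)

lemma gain_matrix_min_eigenvalue_pos:
  assumes a: "a > 0" and disc: "b\<^sup>2 < 4 * a * c"
  shows "0 < min_eigenvalue (gain_matrix a b c)"
proof (rule min_eigenvalue_pos[OF gain_matrix_symmetric])
  fix y :: "real^2" assume y: "y \<noteq> 0"
  \<comment> \<open>Complete the square in the first variable.\<close>
  have "4 * a * (y \<bullet> (gain_matrix a b c *v y))
      = (2 * a * y$1 - b * y$2)\<^sup>2 + (4 * a * c - b\<^sup>2) * (y$2)\<^sup>2"
    unfolding gain_matrix_form by (simp add: power2_eq_square algebra_simps)
  also have "\<dots> > 0"
  proof (cases "y$2 = 0")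
    case True
    then have "y$1 \<noteq> 0" using y by (auto simp: vec_eq_iff forall_2)
    then show ?thesis using True a by simp
  next
    case False
    then show ?thesis using disc by (intro add_nonneg_pos mult_pos_pos) auto
  qed
  finally show "0 < y \<bullet> (gain_matrix a b c *v y)" using a by (simp add: zero_less_mult_iff)
qed

section \<open>The Laplacian grounded at the observed coordinates\<close>

text \<open>The matrix acts blockwise: for each coordinate \<open>j\<close> it is the graph Laplacian on the players'
  estimates of \<open>x\<^sub>j\<close>, grounded at the neighbours of \<open>j\<close>, which observe \<open>x\<^sub>j\<close> directly.\<close>

abbreviation grounded_laplacian :: "('n::finite \<times> 'n) set \<Rightarrow> real^('n \<times> 'n)^('n \<times> 'n)" where
  "grounded_laplacian E \<equiv> kronecker_product (laplacian E) (mat 1) + adjacency_diag E"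

lemma adjacency_sym: "undirected_graph E \<Longrightarrow> adjacency E $ i $ j = adjacency E $ j $ i"
  by (auto simp: undirected_graph_def adjacency_def dest: symD)

lemma adjacency_nonneg: "0 \<le> adjacency E $ i $ j"
  by (simp add: adjacency_def)

lemma sum_UNIV_prod: "(\<Sum>p\<in>UNIV. g p) = (\<Sum>i\<in>UNIV. \<Sum>j\<in>UNIV. g (i, j))"
  by (metis UNIV_Times_UNIV split_conv sum.cartesian_product' sum.cong surj_pair)

lemma grounded_laplacian_apply:
  fixes y :: "real^('n::finite \<times> 'n)"
  shows "(grounded_laplacian E *v y) $ (i, j) =
    (\<Sum>k\<in>UNIV. adjacency E $ i $ k * (y $ (i, j) - y $ (k, j))) + adjacency E $ i $ j * y $ (i, j)"
proof -
  have "(grounded_laplacian E *v y) $ (i, j)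
      = (\<Sum>k\<in>UNIV. \<Sum>l\<in>UNIV. (laplacian E $ i $ k * (if j = l then 1 else 0)
          + (if i = k \<and> j = l then adjacency E $ i $ j else 0)) * y $ (k, l))"
    unfolding matrix_vector_mult_def sum_UNIV_prod
    by (simp add: kronecker_product_def adjacency_diag_def mat_def cong: if_cong)
  also have "\<dots> = (\<Sum>k\<in>UNIV. laplacian E $ i $ k * y $ (k, j)
      + (if i = k then adjacency E $ i $ j * y $ (k, j) else 0))"
    by (intro sum.cong refl)
       (simp add: distrib_right sum.distrib mult_delta_left mult_delta_right flip: if_if_eq_conj)
  also have "\<dots> = (\<Sum>k\<in>UNIV. (if i = k then (\<Sum>k\<in>UNIV. adjacency E $ i $ k) * y $ (k, j) else 0)
      - adjacency E $ i $ k * y $ (k, j)) + adjacency E $ i $ j * y $ (i, j)"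
    by (simp add: sum.distrib laplacian_def left_diff_distrib mult_delta_left)
  also have "\<dots> = (\<Sum>k\<in>UNIV. adjacency E $ i $ k * (y $ (i, j) - y $ (k, j)))
      + adjacency E $ i $ j * y $ (i, j)"
    by (simp add: sum_subtractf sum_distrib_right right_diff_distrib)
  finally show ?thesis .
qed

lemma grounded_laplacian_symmetric:
  assumes "undirected_graph E"
  shows "transpose (grounded_laplacian E) = grounded_laplacian E"
  using adjacency_sym[OF assms]
  by (auto simp: transpose_def kronecker_product_def adjacency_diag_def laplacian_def mat_def
      vec_eq_iff)

text \<open>Symmetrising the Laplacian part over the two orientations of each edge turns it into a sum of
  squares of differences.\<close>

lemma grounded_laplacian_form:
  fixes y :: "real^('n::finite \<times> 'n)"
  assumes "undirected_graph E"
  shows "y \<bullet> (grounded_laplacian E *v y) =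
    (\<Sum>j\<in>UNIV. (\<Sum>i\<in>UNIV. \<Sum>k\<in>UNIV. adjacency E $ i $ k * (y $ (i, j) - y $ (k, j))\<^sup>2) / 2
       + (\<Sum>i\<in>UNIV. adjacency E $ i $ j * (y $ (i, j))\<^sup>2))"
proof -
  have edges: "(\<Sum>i\<in>UNIV. \<Sum>k\<in>UNIV. adjacency E $ i $ k * (y $ (i, j) - y $ (k, j))\<^sup>2) / 2
      = (\<Sum>i\<in>UNIV. \<Sum>k\<in>UNIV. y $ (i, j) * (adjacency E $ i $ k * (y $ (i, j) - y $ (k, j))))"
    (is "?L / 2 = ?R") for j
  proof -
    have "?L = ?R - (\<Sum>i\<in>UNIV. \<Sum>k\<in>UNIV. y $ (k, j) * (adjacency E $ i $ k * (y $ (i, j) - y $ (k, j))))"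
      by (simp add: sum_subtractf[symmetric] power2_eq_square algebra_simps)
    also have "(\<Sum>i\<in>UNIV. \<Sum>k\<in>UNIV. y $ (k, j) * (adjacency E $ i $ k * (y $ (i, j) - y $ (k, j)))) = - ?R"
      by (subst sum.swap)
         (simp add: adjacency_sym[OF assms] sum_negf[symmetric] algebra_simps)
    finally show ?thesis by simp
  qed
  have "y \<bullet> (grounded_laplacian E *v y)
      = (\<Sum>i\<in>UNIV. \<Sum>j\<in>UNIV. y $ (i, j) * (grounded_laplacian E *v y) $ (i, j))"
    unfolding inner_vec_def sum_UNIV_prod by simp
  also have "\<dots> = (\<Sum>j\<in>UNIV. \<Sum>i\<in>UNIV. y $ (i, j) * (grounded_laplacian E *v y) $ (i, j))"
    by (rule sum.swap)
  also have "\<dots> = (\<Sum>j\<in>UNIV. (\<Sum>i\<in>UNIV. \<Sum>k\<in>UNIV. y $ (i, j) * (adjacency E $ i $ k * (y $ (i, j) - y $ (k, j))))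
      + (\<Sum>i\<in>UNIV. adjacency E $ i $ j * (y $ (i, j))\<^sup>2))"
    unfolding grounded_laplacian_apply
    by (simp add: distrib_left sum.distrib sum_distrib_left power2_eq_square mult.left_commute)
  finally show ?thesis unfolding edges .
qed

text \<open>If the form vanishes, then for each \<open>j\<close> the values \<open>y\<^sub>i\<^sub>j\<close> agree along edges, so they do not depend
  on \<open>i\<close> by connectedness, and they vanish at the neighbours of \<open>j\<close>. With at least two nodes,
  connectedness provides such a neighbour, so \<open>y = 0\<close>.\<close>

lemma grounded_laplacian_pos:
  fixes y :: "real^('n::finite \<times> 'n)"
  assumes G: "undirected_graph E" "connected_graph E" and card: "CARD('n) \<ge> 2"
    and y: "y \<noteq> 0"
  shows "0 < y \<bullet> (grounded_laplacian E *v y)"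
proof -
  let ?e = "\<lambda>j i k. adjacency E $ i $ k * (y $ (i, j) - y $ (k, j))\<^sup>2"
  let ?g = "\<lambda>j i. adjacency E $ i $ j * (y $ (i, j))\<^sup>2"
  let ?S = "\<lambda>j. (\<Sum>i\<in>UNIV. \<Sum>k\<in>UNIV. ?e j i k) / 2 + (\<Sum>i\<in>UNIV. ?g j i)"
  have e0: "?e j i k \<ge> 0" and g0: "?g j i \<ge> 0" for i j k
    by (simp_all add: adjacency_nonneg)
  have S0: "?S j \<ge> 0" for j
    using e0 g0 by (simp add: sum_nonneg)
  have form: "y \<bullet> (grounded_laplacian E *v y) = (\<Sum>j\<in>UNIV. ?S j)"
    by (rule grounded_laplacian_form[OF G(1)])
  have "y \<bullet> (grounded_laplacian E *v y) \<noteq> 0"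
  proof
    assume "y \<bullet> (grounded_laplacian E *v y) = 0"
    then have S: "?S j = 0" for j
      unfolding form using S0 by (subst (asm) sum_nonneg_eq_0_iff) auto
    have e: "?e j i k = 0" and g: "?g j i = 0" for i j k
    proof -
      have a: "0 \<le> (\<Sum>i\<in>UNIV. \<Sum>k\<in>UNIV. ?e j i k)" and b: "0 \<le> (\<Sum>i\<in>UNIV. ?g j i)"
        by (intro sum_nonneg e0 g0)+
      have "(\<Sum>i\<in>UNIV. ?g j i) = 0" using a b S[of j] by linarith
      then show "?g j i = 0" using g0 by (subst (asm) sum_nonneg_eq_0_iff) auto
      have "(\<Sum>i\<in>UNIV. \<Sum>k\<in>UNIV. ?e j i k) = 0" using a b S[of j] by linarith
      then have "(\<Sum>k\<in>UNIV. ?e j i k) = 0"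
        using e0 by (subst (asm) sum_nonneg_eq_0_iff) (auto intro: sum_nonneg)
      then show "?e j i k = 0" using e0 by (subst (asm) sum_nonneg_eq_0_iff) auto
    qed
    have edge: "y $ (i, j) = y $ (k, j)" if "(i, k) \<in> E" for i j k
      using e[where i = k and k = i and j = j] that by (simp add: adjacency_def)
    have const: "y $ (i, j) = y $ (k, j)" for i j k
    proof -
      have "(i, k) \<in> E\<^sup>*" using G(2) by (simp add: connected_graph_def)
      then show ?thesis by induction (auto dest: edge)
    qed
    have "y $ (i, j) = 0" for i j
    proof -
      have "\<exists>k. k \<noteq> j"
      proof (rule ccontr)
        assume "\<nexists>k. k \<noteq> j"
        then have "(UNIV :: 'n set) = {j}" by auto
        then have "CARD('n) = 1" by (metis card.empty card_insert_disjoint finite.emptyI empty_iff One_nat_def)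
        then show False using card by simp
      qed
      then obtain k where "k \<noteq> j" by blast
      moreover have "(j, k) \<in> E\<^sup>*" using G(2) by (simp add: connected_graph_def)
      ultimately obtain b where "(j, b) \<in> E" by (metis converse_rtranclE)
      then have "y $ (b, j) = 0" using g[where i = b and j = j] by (simp add: adjacency_def)
      then show ?thesis using const by metis
    qed
    then show False using y by (auto simp: vec_eq_iff)
  qed
  moreover have "y \<bullet> (grounded_laplacian E *v y) \<ge> 0"
    unfolding form using S0 by (rule sum_nonneg)
  ultimately show ?thesis by simp
qed

text \<open>The action of the grounded Laplacian with vectors indexed by pairs written as matrices, the
  shape in which the estimates occur in the closed loop.\<close>

definition consensus_operator :: "('n::finite \<times> 'n) set \<Rightarrow> real^'n^'n \<Rightarrow> real^'n^'n" where
  "consensus_operator E Z = (\<chi> i j. (\<Sum>k\<in>UNIV. adjacency E $ i $ k * (Z $ i $ j - Z $ k $ j))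
      + adjacency E $ i $ j * Z $ i $ j)"

lemma consensus_operator_coercive:
  fixes Z :: "real^'n^'n"
  assumes "undirected_graph E"
  shows "min_eigenvalue (grounded_laplacian E) * (norm Z)\<^sup>2 \<le> Z \<bullet> consensus_operator E Z"
proof -
  define flat :: "real^'n^'n \<Rightarrow> real^('n \<times> 'n)" where "flat W = (\<chi> p. W $ fst p $ snd p)" for W
  have inner: "flat W \<bullet> flat W' = W \<bullet> W'" for W W'
    by (simp add: flat_def inner_vec_def sum_UNIV_prod)
  have "grounded_laplacian E *v flat Z = flat (consensus_operator E Z)"
  proof -
    have "(grounded_laplacian E *v flat Z) $ (i, j) = flat (consensus_operator E Z) $ (i, j)" for i j
      unfolding grounded_laplacian_apply by (simp add: flat_def consensus_operator_def)
    then show ?thesis by (simp add: vec_eq_iff)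
  qed
  then show ?thesis
    using symmetric_matrix_min_eigenvalue(2)[OF grounded_laplacian_symmetric[OF assms], of "flat Z"]
    by (simp add: power2_norm_eq_inner inner)
qed

section \<open>Calculus of vector-valued functions\<close>

lemma has_derivative_vecI:
  fixes F :: "'a::real_normed_vector \<Rightarrow> 'b::euclidean_space^'n::finite"
  assumes "\<And>i. ((\<lambda>x. F x $ i) has_derivative (\<lambda>h. F' h $ i)) (at a within S)"
  shows "(F has_derivative F') (at a within S)"
  unfolding has_derivative_componentwise_within[of F]
  by (auto simp: Basis_vec_def inner_axis intro!: derivative_eq_intros assms has_derivative_inner_left)

lemma has_vector_derivative_vecI:
  fixes F :: "real \<Rightarrow> 'b::euclidean_space^'n::finite"
  assumes "\<And>i. ((\<lambda>t. F t $ i) has_vector_derivative D $ i) (at t within S)"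
  shows "(F has_vector_derivative D) (at t within S)"
  using assms unfolding has_vector_derivative_def by (intro has_derivative_vecI) simp

lemma norm_vec_const: "norm ((\<chi> i. p) :: 'a::real_normed_vector^'n::finite) = sqrt (real CARD('n)) * norm p"
  by (simp add: norm_vec_def L2_set_def real_sqrt_mult)

lemma stack_has_vector_derivative:
  fixes F :: "real \<Rightarrow> 'a::euclidean_space"
  assumes "(F has_vector_derivative D) (at t within S)"
  shows "((\<lambda>t. (\<chi> i. F t) :: 'a^'n::finite) has_vector_derivative (\<chi> i. D)) (at t within S)"
  by (rule has_vector_derivative_vecI) (use assms in simp)

lemma half_squared_norm_derivative:
  fixes F :: "real \<Rightarrow> 'a::real_inner"
  assumes "(F has_vector_derivative D) (at t within S)"
  shows "((\<lambda>t. (norm (F t))\<^sup>2 / 2) has_real_derivative F t \<bullet> D) (at t within S)"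
proof -
  have "((\<lambda>t. F t \<bullet> F t) has_real_derivative 2 * (F t \<bullet> D)) (at t within S)"
    using bounded_bilinear.has_vector_derivative[OF bounded_bilinear_inner assms assms]
    by (simp add: has_real_derivative_iff_has_vector_derivative inner_commute)
  from DERIV_cdivide[OF this, of 2] show ?thesis by (simp add: power2_norm_eq_inner)
qed

section \<open>Exponential decay\<close>

text \<open>Under the differential inequality the product \<open>exp (c t) V t\<close> is nonincreasing.\<close>

lemma exponential_decay:
  fixes V V' :: "real \<Rightarrow> real"
  assumes deriv: "\<And>t. t \<ge> 0 \<Longrightarrow> (V has_real_derivative V' t) (at t within {0..})"
    and le: "\<And>t. t \<ge> 0 \<Longrightarrow> V' t \<le> - c * V t"
    and t: "t \<ge> 0"
  shows "V t \<le> V 0 * exp (- c * t)"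
proof -
  define W where "W s = exp (c * s) * V s" for s
  have W: "(W has_real_derivative exp (c * s) * (c * V s + V' s)) (at s within {0..})"
    if "s \<ge> 0" for s
    unfolding W_def using deriv[OF that]
    by (auto intro!: derivative_eq_intros simp: algebra_simps)
  have "W t \<le> W 0"
  proof (rule DERIV_nonpos_imp_decreasing_open[OF t])
    fix s :: real assume s: "0 < s" "s < t"
    have "(W has_real_derivative exp (c * s) * (c * V s + V' s)) (at s)"
      using W[of s] s at_within_interior[of s "{0..}"] by simp
    moreover have "exp (c * s) * (c * V s + V' s) \<le> 0"
      using le[of s] s by (intro mult_nonneg_nonpos) auto
    ultimately show "\<exists>y. (W has_real_derivative y) (at s) \<and> y \<le> 0" by blast
  next
    have "continuous_on {0..} W"
      by (rule DERIV_continuous_on[where D = "\<lambda>s. exp (c * s) * (c * V s + V' s)"]) (simp add: W)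
    then show "continuous_on {0..t} W" by (rule continuous_on_subset) auto
  qed
  have "V t = W t * exp (- c * t)" by (simp add: W_def exp_minus)
  also have "\<dots> \<le> W 0 * exp (- c * t)" using \<open>W t \<le> W 0\<close> by (intro mult_right_mono) auto
  finally show ?thesis by (simp add: W_def)
qed

lemma norm_tendsto_zero_if_exponentially_bounded:
  assumes "c > 0" and "\<And>t. t \<ge> 0 \<Longrightarrow> (norm (F t))\<^sup>2 \<le> K * exp (- c * t)"
  shows "((\<lambda>t::real. norm (F t)) \<longlongrightarrow> 0) at_top"
proof -
  have "((\<lambda>t. K * exp (- c * t)) \<longlongrightarrow> K * 0) at_top"
    by (intro tendsto_mult tendsto_const filterlim_compose[OF exp_at_bot]
        filterlim_tendsto_neg_mult_at_bot[OF tendsto_const] filterlim_ident) (use assms(1) in auto)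
  then have "((\<lambda>t. sqrt (K * exp (- c * t))) \<longlongrightarrow> 0) at_top"
    using tendsto_real_sqrt[of "\<lambda>t. K * exp (- c * t)"] by fastforce
  moreover have "\<forall>\<^sub>F t in at_top. norm (norm (F t)) \<le> sqrt (K * exp (- c * t))"
    using eventually_ge_at_top[of 0] by eventually_elim (use assms(2) in \<open>simp add: real_le_rsqrt\<close>)
  ultimately show ?thesis by (rule Lim_null_comparison[rotated])
qed

section \<open>Derivatives of the pseudo-gradient\<close>

lemma replace_coord_eq: "replace_coord x i s = x + (s - x $ i) *\<^sub>R axis i 1"
  by (auto simp: replace_coord_def vec_eq_iff axis_def)

lemma replace_coord_same [simp]: "replace_coord x i (x $ i) = x"
  by (simp add: replace_coord_eq)

lemma has_real_derivative_along_coordinate: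
  fixes g :: "real^'n::finite \<Rightarrow> real"
  assumes "(g has_derivative g') (at x)"
  shows "((\<lambda>s. g (replace_coord x i s)) has_real_derivative g' (axis i 1)) (at (x $ i))"
proof -
  have "((\<lambda>s. replace_coord x i s) has_derivative (\<lambda>s. s *\<^sub>R axis i 1)) (at (x $ i))"
    unfolding replace_coord_eq by (auto intro!: derivative_eq_intros)
  then have "((\<lambda>s. g (replace_coord x i s)) has_derivative (\<lambda>s. g' (s *\<^sub>R axis i 1))) (at (x $ i))"
    using assms by (intro has_derivative_compose[of "replace_coord x i" _ _ _ g]) auto
  then show ?thesis
    by (simp add: has_real_derivative_iff_has_vector_derivative has_vector_derivative_def
        linear.scaleR[OF has_derivative_linear[OF assms]])
qed

lemma partial_deriv_eq:
  fixes g :: "real^'n::finite \<Rightarrow> real"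
  assumes "(g has_derivative g') (at x)"
  shows "partial_deriv i g x = g' (axis i 1)"
  unfolding partial_deriv_def
  by (rule DERIV_imp_deriv[OF has_real_derivative_along_coordinate[OF assms]])

text \<open>The mean value theorem applied once in direction \<open>u\<close> and once in direction \<open>v\<close>. The second
  difference on the left is symmetric in \<open>u\<close> and \<open>v\<close>, the right-hand side is not obviously so.\<close>

lemma second_difference_quotient:
  fixes g :: "'a::real_normed_vector \<Rightarrow> real" and g' :: "'a \<Rightarrow> 'a \<Rightarrow>\<^sub>L real"
  assumes g': "\<And>x. (g has_derivative blinfun_apply (g' x)) (at x)"
    and g'': "\<And>x. (g' has_derivative blinfun_apply (g'' x)) (at x)"
    and t: "t > 0"
  obtains r s where "0 < r" "r < t" "0 < s" "s < t"
    "g (x + t *\<^sub>R u + t *\<^sub>R v) - g (x + t *\<^sub>R u) - g (x + t *\<^sub>R v) + g x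
      = t\<^sup>2 * g'' (x + s *\<^sub>R u + r *\<^sub>R v) v u"
proof -
  define \<phi> where "\<phi> s = g (x + s *\<^sub>R u + t *\<^sub>R v) - g (x + s *\<^sub>R u)" for s
  have \<phi>: "(\<phi> has_real_derivative g' (x + s *\<^sub>R u + t *\<^sub>R v) u - g' (x + s *\<^sub>R u) u) (at s)" for s
  proof -
    have "((\<lambda>s. g (x + s *\<^sub>R u + w)) has_derivative (\<lambda>h. g' (x + s *\<^sub>R u + w) (h *\<^sub>R u))) (at s)" for w
      by (rule has_derivative_compose[OF _ g']) (auto intro!: derivative_eq_intros)
    from has_derivative_diff[OF this[of "t *\<^sub>R v"] this[of 0]] show ?thesis
      by (simp add: \<phi>_def[abs_def] has_real_derivative_iff_has_vector_derivative
          has_vector_derivative_def blinfun.scaleR_right right_diff_distrib)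
  qed
  obtain s where s: "0 < s" "s < t"
    "\<phi> t - \<phi> 0 = (t - 0) * (g' (x + s *\<^sub>R u + t *\<^sub>R v) u - g' (x + s *\<^sub>R u) u)"
    using MVT2[OF t \<phi>] by blast
  define \<psi> where "\<psi> r = g' (x + s *\<^sub>R u + r *\<^sub>R v) u" for r
  have \<psi>: "(\<psi> has_real_derivative g'' (x + s *\<^sub>R u + r *\<^sub>R v) v u) (at r)" for r
  proof -
    have "((\<lambda>r. g' (x + s *\<^sub>R u + r *\<^sub>R v)) has_derivative
        (\<lambda>h. g'' (x + s *\<^sub>R u + r *\<^sub>R v) (h *\<^sub>R v))) (at r)"
      by (rule has_derivative_compose[OF _ g'']) (auto intro!: derivative_eq_intros)
    from bounded_linear.has_derivative[OF blinfun.bounded_linear_left this, of u] show ?thesis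
      by (simp add: \<psi>_def[abs_def] has_real_derivative_iff_has_vector_derivative
          has_vector_derivative_def blinfun.scaleR_right blinfun.scaleR_left)
  qed
  obtain r where r: "0 < r" "r < t" "\<psi> t - \<psi> 0 = (t - 0) * g'' (x + s *\<^sub>R u + r *\<^sub>R v) v u"
    using MVT2[OF t \<psi>] by blast
  have "g (x + t *\<^sub>R u + t *\<^sub>R v) - g (x + t *\<^sub>R u) - g (x + t *\<^sub>R v) + g x = \<phi> t - \<phi> 0"
    by (simp add: \<phi>_def)
  also have "\<dots> = t * (\<psi> t - \<psi> 0)" using s by (simp add: \<psi>_def)
  also have "\<dots> = t\<^sup>2 * g'' (x + s *\<^sub>R u + r *\<^sub>R v) v u"
    using r by (simp add: power2_eq_square)
  finally show ?thesis using that r s by blast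
qed

text \<open>Schwarz's theorem: both orders of differentiation are the limit of the same symmetric
  second difference quotient, by continuity of the second derivative.\<close>

lemma second_derivative_symmetric:
  fixes g :: "'a::real_normed_vector \<Rightarrow> real" and g' :: "'a \<Rightarrow> 'a \<Rightarrow>\<^sub>L real"
  assumes g': "\<And>x. (g has_derivative blinfun_apply (g' x)) (at x)"
    and g'': "\<And>x. (g' has_derivative blinfun_apply (g'' x)) (at x)"
    and cont: "continuous_on UNIV g''"
  shows "g'' x u v = g'' x v u"
proof -
  have lim: "((\<lambda>t. (g (x + t *\<^sub>R u + t *\<^sub>R v) - g (x + t *\<^sub>R u) - g (x + t *\<^sub>R v) + g x) / t\<^sup>2)
      \<longlongrightarrow> g'' x v u) (at_right 0)" (is "(?q u v \<longlongrightarrow> _) _") for u v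
  proof -
    have "\<forall>t. \<exists>r s. t > 0 \<longrightarrow> 0 < r \<and> r < t \<and> 0 < s \<and> s < t \<and>
        ?q u v t = g'' (x + s *\<^sub>R u + r *\<^sub>R v) v u"
      using second_difference_quotient[OF g' g'', of _ x u v] by (metis nonzero_mult_div_cancel_left less_irrefl power_eq_0_iff)
    then obtain r s where rs: "\<And>t. t > 0 \<Longrightarrow> 0 < r t \<and> r t < t \<and> 0 < s t \<and> s t < t \<and>
        ?q u v t = g'' (x + s t *\<^sub>R u + r t *\<^sub>R v) v u" by metis
    have pos: "\<forall>\<^sub>F t in at_right 0. (t::real) > 0" by (simp add: eventually_at_filter)
    have id: "((\<lambda>t. t) \<longlongrightarrow> (0::real)) (at_right 0)" by (rule tendsto_ident_at)
    have "(r \<longlongrightarrow> 0) (at_right 0)" "(s \<longlongrightarrow> 0) (at_right 0)"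
      by (rule tendsto_sandwich[OF _ _ tendsto_const id]; rule eventually_mono[OF pos];
          use rs in \<open>force intro: less_imp_le\<close>)+
    then have "((\<lambda>t. x + s t *\<^sub>R u + r t *\<^sub>R v) \<longlongrightarrow> x + 0 *\<^sub>R u + 0 *\<^sub>R v) (at_right 0)"
      by (intro tendsto_intros)
    then have "((\<lambda>t. g'' (x + s t *\<^sub>R u + r t *\<^sub>R v)) \<longlongrightarrow> g'' x) (at_right 0)"
      using cont by (intro continuous_on_tendsto_compose[of UNIV g'']) auto
    then have "((\<lambda>t. g'' (x + s t *\<^sub>R u + r t *\<^sub>R v) v u) \<longlongrightarrow> g'' x v u) (at_right 0)"
      by (intro tendsto_intros)
    then show ?thesis
    proof (rule Lim_transform_eventually)
      show "\<forall>\<^sub>F t in at_right 0. g'' (x + s t *\<^sub>R u + r t *\<^sub>R v) v u = ?q u v t"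
        by (rule eventually_mono[OF pos]) (simp only: rs)
    qed
  qed
  have "?q u v = ?q v u" by (auto simp: algebra_simps)
  then show ?thesis
    using tendsto_unique[OF _ lim[of u v]] lim[of v u] by simp
qed

text \<open>Differentiating \<open>\<partial>f\<^sub>i/\<partial>x\<^sub>i\<close> in direction \<open>j\<close> gives \<open>\<partial>\<^sub>j\<partial>\<^sub>if\<^sub>i\<close>, whereas the game Hessian contains
  \<open>\<partial>\<^sub>i\<partial>\<^sub>jf\<^sub>i\<close>; symmetry of second derivatives identifies the two, and so makes the Hessian the Jacobian
  of the pseudo-gradient.\<close>

lemma pseudo_gradient_has_derivative:
  fixes f :: "'n::finite \<Rightarrow> real^'n \<Rightarrow> real"
  assumes "\<And>i. twice_continuously_differentiable (f i)"
  shows "(pseudo_gradient f has_derivative (\<lambda>h. game_hessian f p *v h)) (at p)"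
proof (rule has_derivative_vecI)
  fix i
  obtain g' :: "(real^'n) \<Rightarrow> (real^'n) \<Rightarrow>\<^sub>L real" and g''
    where g': "\<And>x. (f i has_derivative blinfun_apply (g' x)) (at x)"
      and g'': "\<And>x. (g' has_derivative blinfun_apply (g'' x)) (at x)"
      and cont: "continuous_on UNIV g''"
    using assms[of i] unfolding twice_continuously_differentiable_def by blast
  have partial: "partial_deriv j (f i) = (\<lambda>x. g' x (axis j 1))" for j
    using partial_deriv_eq[OF g'] by blast
  have D: "(partial_deriv j (f i) has_derivative (\<lambda>h. g'' x h (axis j 1))) (at x)" for j x
    unfolding partial by (rule bounded_linear.has_derivative[OF blinfun.bounded_linear_left g''])
  have entry: "game_hessian f p $ i $ j = g'' p (axis j 1) (axis i 1)" for j
    using second_derivative_symmetric[OF g' g'' cont, of p "axis i 1" "axis j 1"]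
    by (simp add: game_hessian_def partial_deriv_eq[OF D])
  have "(game_hessian f p *v h) $ i = g'' p h (axis i 1)" for h
  proof -
    have "g'' p h (axis i 1) = g'' p (\<Sum>j\<in>UNIV. h $ j *\<^sub>R axis j 1) (axis i 1)"
      by (simp add: basis_expansion flip: scalar_mult_eq_scaleR)
    also have "\<dots> = (\<Sum>j\<in>UNIV. g'' p (axis j 1) (axis i 1) * h $ j)"
      by (simp add: blinfun.sum_right blinfun.sum_left blinfun.scaleR_right blinfun.scaleR_left mult.commute)
    finally show ?thesis by (simp add: matrix_vector_mult_def entry)
  qed
  then show "((\<lambda>x. pseudo_gradient f x $ i) has_derivative (\<lambda>h. (game_hessian f p *v h) $ i)) (at p)"
    using D[of i p] by (simp add: pseudo_gradient_def)
qed

lemma nash_equilibrium_pseudo_gradient_zero: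
  fixes f :: "'n::finite \<Rightarrow> real^'n \<Rightarrow> real"
  assumes smooth: "\<And>i. twice_continuously_differentiable (f i)" and nash: "nash_equilibrium f p"
  shows "pseudo_gradient f p = 0"
proof -
  have "partial_deriv i (f i) p = 0" for i
  proof -
    obtain g' where g': "(f i has_derivative g') (at p)"
      using smooth[of i] unfolding twice_continuously_differentiable_def by blast
    have "g' (axis i 1) = 0"
    proof (rule DERIV_local_min[OF has_real_derivative_along_coordinate[OF g'] zero_less_one])
      show "\<forall>s. \<bar>p $ i - s\<bar> < 1 \<longrightarrow> f i (replace_coord p i (p $ i)) \<le> f i (replace_coord p i s)"
        using nash by (simp add: nash_equilibrium_def)
    qed
    then show ?thesis by (simp add: partial_deriv_eq[OF g'])
  qed
  then show ?thesis by (simp add: pseudo_gradient_def vec_eq_iff)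
qed

text \<open>Row \<open>i\<close> of \<open>Z\<close> is the point at which player \<open>i\<close> evaluates its own partial derivative. For the
  estimates of the players this bounds the effect of the estimation error; with all rows equal it
  is a Lipschitz bound for the pseudo-gradient.\<close>

lemma stacked_gradient_lipschitz:
  fixes f :: "'n::finite \<Rightarrow> real^'n \<Rightarrow> real"
  assumes lip: "\<And>i. (l i)-lipschitz_on UNIV (partial_deriv i (f i))"
  shows "norm ((\<chi> i. partial_deriv i (f i) (Z $ i)) - pseudo_gradient f p)
    \<le> Max (range l) * norm (Z - (\<chi> i. p))"
proof -
  have L0: "0 \<le> Max (range l)"
    using lipschitz_on_nonneg[OF lip] Max_ge[of "range l"] by (meson finite_imageI finite order_trans rangeI)
  have "norm ((\<chi> i. partial_deriv i (f i) (Z $ i)) - pseudo_gradient f p)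
      \<le> L2_set (\<lambda>i. Max (range l) * norm ((Z - (\<chi> i. p)) $ i)) UNIV"
    unfolding norm_vec_def[of "(\<chi> i. partial_deriv i (f i) (Z $ i)) - pseudo_gradient f p"]
  proof (rule L2_set_mono)
    fix i
    have "norm (partial_deriv i (f i) (Z $ i) - partial_deriv i (f i) p) \<le> l i * norm (Z $ i - p)"
      using lipschitz_onD[OF lip[of i]] by (simp add: dist_norm)
    also have "\<dots> \<le> Max (range l) * norm (Z $ i - p)"
      by (intro mult_right_mono) auto
    finally show "norm (((\<chi> i. partial_deriv i (f i) (Z $ i)) - pseudo_gradient f p) $ i)
        \<le> Max (range l) * norm ((Z - (\<chi> i. p)) $ i)"
      by (simp add: pseudo_gradient_def)
  qed simp
  also have "\<dots> = Max (range l) * norm (Z - (\<chi> i. p))"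
    unfolding norm_vec_def[of "Z - (\<chi> i. p)"] by (simp add: L2_set_right_distrib[OF L0])
  finally show ?thesis .
qed

section \<open>Dissipation of the Lyapunov function\<close>

text \<open>The three player errors \<open>a\<close>, \<open>b\<close>, \<open>d\<close> are merged into one magnitude \<open>\<rho>\<close>, on which the dissipation
  without the estimation error \<open>r\<close> is at least \<open>\<mu> \<rho>\<^sup>2\<close>. Each coupling term is at most a multiple of \<open>\<rho> r\<close>,
  with multiples summing to \<open>\<kappa>\<close>, so a binary quadratic form in \<open>\<rho>\<close> and \<open>r\<close> remains.\<close>

lemma dissipation_scalar:
  fixes a b d r m h k1 k2 L s \<Lambda> \<mu> \<kappa> :: real
  defines "\<mu> \<equiv> min (min_eigenvalue (gain_matrix m (h * s * L + 1) (k1 - h))) (k2 - k1)"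
    and "\<kappa> \<equiv> 2 * k1 * L + s + s\<^sup>2 * L"
  assumes nonneg: "a \<ge> 0" "b \<ge> 0" "d \<ge> 0" "r \<ge> 0" "k1 \<ge> 0" "L \<ge> 0" "s \<ge> 0"
  shows "- (m * a\<^sup>2) + (h * s * L + 1) * a * b - (k1 - h) * b\<^sup>2 - (k2 - k1) * d\<^sup>2 - \<Lambda> * r\<^sup>2
      + r * (k1 * L * b + k1 * L * d + s * b + s\<^sup>2 * L * a)
    \<le> - (min_eigenvalue (gain_matrix \<mu> \<kappa> \<Lambda>)) * (a\<^sup>2 + b\<^sup>2 + d\<^sup>2 + r\<^sup>2)"
proof -
  define \<rho> where "\<rho> = sqrt (a\<^sup>2 + b\<^sup>2 + d\<^sup>2)"
  have \<rho>2: "\<rho>\<^sup>2 = a\<^sup>2 + b\<^sup>2 + d\<^sup>2" by (simp add: \<rho>_def)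
  have le: "a \<le> \<rho>" "b \<le> \<rho>" "d \<le> \<rho>"
    unfolding \<rho>_def by (rule real_le_rsqrt, simp)+
  have "\<mu> * (a\<^sup>2 + b\<^sup>2) \<le> min_eigenvalue (gain_matrix m (h * s * L + 1) (k1 - h)) * (a\<^sup>2 + b\<^sup>2)"
    by (intro mult_right_mono) (auto simp: \<mu>_def)
  also have "\<dots> \<le> m * a\<^sup>2 - (h * s * L + 1) * a * b + (k1 - h) * b\<^sup>2"
    by (rule gain_matrix_lower_bound)
  finally have 1: "\<mu> * (a\<^sup>2 + b\<^sup>2) \<le> m * a\<^sup>2 - (h * s * L + 1) * a * b + (k1 - h) * b\<^sup>2" .
  have 2: "\<mu> * d\<^sup>2 \<le> (k2 - k1) * d\<^sup>2"
    by (intro mult_right_mono) (auto simp: \<mu>_def)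
  have "k1 * L * b + k1 * L * d + s * b + s\<^sup>2 * L * a
      \<le> k1 * L * \<rho> + k1 * L * \<rho> + s * \<rho> + s\<^sup>2 * L * \<rho>"
    using nonneg le by (intro add_mono mult_left_mono) auto
  then have "r * (k1 * L * b + k1 * L * d + s * b + s\<^sup>2 * L * a)
      \<le> r * (k1 * L * \<rho> + k1 * L * \<rho> + s * \<rho> + s\<^sup>2 * L * \<rho>)"
    using nonneg by (intro mult_left_mono) auto
  also have "\<dots> = \<kappa> * \<rho> * r" by (simp add: \<kappa>_def algebra_simps)
  finally have 3: "r * (k1 * L * b + k1 * L * d + s * b + s\<^sup>2 * L * a) \<le> \<kappa> * \<rho> * r" .
  have 4: "min_eigenvalue (gain_matrix \<mu> \<kappa> \<Lambda>) * (a\<^sup>2 + b\<^sup>2 + d\<^sup>2 + r\<^sup>2)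
      \<le> \<mu> * (a\<^sup>2 + b\<^sup>2 + d\<^sup>2) - \<kappa> * \<rho> * r + \<Lambda> * r\<^sup>2"
    using gain_matrix_lower_bound[of \<mu> \<kappa> \<Lambda> \<rho> r] by (simp add: \<rho>2)
  have 5: "\<mu> * (a\<^sup>2 + b\<^sup>2 + d\<^sup>2) = \<mu> * (a\<^sup>2 + b\<^sup>2) + \<mu> * d\<^sup>2"
    by (simp add: algebra_simps)
  show ?thesis using 1 2 3 4 unfolding 5 mult_minus_left by linarith
qed

text \<open>The terms \<open>k\<^sub>1 (w \<bullet> q)\<close> produced by \<open>w\<close> and by \<open>q\<close> have opposite signs and cancel; this is the
  reason for using \<open>q = y - v\<close> as an error variable. Everything else is Cauchy-Schwarz and
  \<open>\<parallel>v\<parallel> \<le> \<parallel>w\<parallel> + s L \<parallel>e\<parallel>\<close>. Here \<open>J\<close> stands for the Jacobian of the pseudo-gradient applied to \<open>v\<close>,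
  and \<open>X\<close> for the velocity copied into every player's row.\<close>

lemma dissipation_vector:
  fixes e w q v P g J :: "'a::real_inner" and \<xi> C X :: "'b::real_inner"
  assumes v: "v = w - P"
    and mono: "m * (norm e)\<^sup>2 \<le> e \<bullet> P"
    and P: "norm P \<le> s * L * norm e"
    and g: "norm (g - P) \<le> L * norm \<xi>"
    and J: "norm J \<le> h * norm v"
    and C: "\<Lambda> * (norm \<xi>)\<^sup>2 \<le> \<xi> \<bullet> C"
    and X: "norm X = s * norm v"
    and nonneg: "k1 \<ge> 0" "k3 \<ge> 0" "h \<ge> 0" "L \<ge> 0" "s \<ge> 0"
  shows "e \<bullet> v + w \<bullet> (J - k1 *\<^sub>R (g + (q + v))) + q \<bullet> (k1 *\<^sub>R (g + (q + v)) - k2 *\<^sub>R q)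
      + \<xi> \<bullet> (- k3 *\<^sub>R C - X)
    \<le> - (m * (norm e)\<^sup>2) + (h * s * L + 1) * norm e * norm w - (k1 - h) * (norm w)\<^sup>2
      - (k2 - k1) * (norm q)\<^sup>2 - (k3 * \<Lambda>) * (norm \<xi>)\<^sup>2
      + norm \<xi> * (k1 * L * norm w + k1 * L * norm q + s * norm w + s\<^sup>2 * L * norm e)"
proof -
  define \<delta> where "\<delta> = g - P"
  have gq: "g + (q + v) = w + q + \<delta>" by (simp add: v \<delta>_def)
  have nv: "norm v \<le> norm w + s * L * norm e"
    using norm_triangle_ineq4[of w P] P by (simp add: v)
  have 1: "e \<bullet> v \<le> norm e * norm w - m * (norm e)\<^sup>2"
    using norm_cauchy_schwarz[of e w] mono by (simp add: v inner_diff_right)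
  have "w \<bullet> J \<le> norm w * norm J" by (rule norm_cauchy_schwarz)
  also have "\<dots> \<le> norm w * (h * norm v)" by (intro mult_left_mono J) simp
  also have "\<dots> \<le> norm w * (h * (norm w + s * L * norm e))"
    using nonneg by (intro mult_left_mono nv) auto
  finally have 2: "w \<bullet> J \<le> h * (norm w)\<^sup>2 + h * s * L * norm e * norm w"
    by (simp add: power2_eq_square algebra_simps)
  have "- (w \<bullet> \<delta>) \<le> norm w * norm \<delta>"
    using norm_cauchy_schwarz[of w "- \<delta>"] by simp
  also have "\<dots> \<le> norm w * (L * norm \<xi>)"
    using g by (intro mult_left_mono) (auto simp: \<delta>_def)
  finally have 3: "k1 * - (w \<bullet> \<delta>) \<le> k1 * (norm w * (L * norm \<xi>))"
    using nonneg by (intro mult_left_mono) auto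
  have "q \<bullet> \<delta> \<le> norm q * norm \<delta>" by (rule norm_cauchy_schwarz)
  also have "\<dots> \<le> norm q * (L * norm \<xi>)"
    using g by (intro mult_left_mono) (auto simp: \<delta>_def)
  finally have 4: "k1 * (q \<bullet> \<delta>) \<le> k1 * (norm q * (L * norm \<xi>))"
    using nonneg by (intro mult_left_mono) auto
  have 5: "k3 * (\<Lambda> * (norm \<xi>)\<^sup>2) \<le> k3 * (\<xi> \<bullet> C)"
    using nonneg by (intro mult_left_mono C) auto
  have "- (\<xi> \<bullet> X) \<le> norm \<xi> * norm X"
    using norm_cauchy_schwarz[of \<xi> "- X"] by simp
  also have "\<dots> \<le> norm \<xi> * (s * (norm w + s * L * norm e))"
    unfolding X using nonneg by (intro mult_left_mono nv) auto
  finally have 6: "- (\<xi> \<bullet> X) \<le> norm \<xi> * (s * (norm w + s * L * norm e))" .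
  have "e \<bullet> v + w \<bullet> (J - k1 *\<^sub>R (g + (q + v))) + q \<bullet> (k1 *\<^sub>R (g + (q + v)) - k2 *\<^sub>R q)
      + \<xi> \<bullet> (- k3 *\<^sub>R C - X)
    = e \<bullet> v + (w \<bullet> J - k1 * (norm w)\<^sup>2 + k1 * - (w \<bullet> \<delta>))
      + (k1 * (q \<bullet> \<delta>) - (k2 - k1) * (norm q)\<^sup>2) + (- (k3 * (\<xi> \<bullet> C)) - \<xi> \<bullet> X)"
    unfolding gq by (simp add: inner_add_right inner_diff_right power2_norm_eq_inner
        inner_commute[of q w] algebra_simps)
  also have "\<dots> \<le> (norm e * norm w - m * (norm e)\<^sup>2)
      + (h * (norm w)\<^sup>2 + h * s * L * norm e * norm w - k1 * (norm w)\<^sup>2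
          + k1 * (norm w * (L * norm \<xi>)))
      + (k1 * (norm q * (L * norm \<xi>)) - (k2 - k1) * (norm q)\<^sup>2)
      + (- (k3 * (\<Lambda> * (norm \<xi>)\<^sup>2)) + norm \<xi> * (s * (norm w + s * L * norm e)))"
    using 1 2 3 4 5 6 by linarith
  also have "\<dots> = - (m * (norm e)\<^sup>2) + (h * s * L + 1) * norm e * norm w - (k1 - h) * (norm w)\<^sup>2
      - (k2 - k1) * (norm q)\<^sup>2 - (k3 * \<Lambda>) * (norm \<xi>)\<^sup>2
      + norm \<xi> * (k1 * L * norm w + k1 * L * norm q + s * norm w + s\<^sup>2 * L * norm e)"
    by (simp add: power2_eq_square algebra_simps)
  finally show ?thesis .
qed

section \<open>The closed loop in vector form\<close>

text \<open>With \<open>y = k\<^sub>2 x - xhat\<close> the filter equation becomes \<open>xhat' = k\<^sub>2 y\<close>, so that \<open>y' = k\<^sub>2 (v - y)\<close>: the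
  variable \<open>y\<close> tracks \<open>v\<close>. Subtracting \<open>x\<close> from each row of \<open>z\<close> changes no difference of estimates
  and turns the observation terms into estimation errors.\<close>

lemma closed_loop_trajectory_vector_form:
  fixes f :: "'n::finite \<Rightarrow> real^'n \<Rightarrow> real"
  assumes traj: "closed_loop_trajectory f E k1 k2 k3 x v xhat z" and t: "t \<ge> 0"
  defines "y \<equiv> k2 *\<^sub>R x t - xhat t"
  shows "(x has_vector_derivative v t) (at t within {0..})"
    and "(v has_vector_derivative - k1 *\<^sub>R ((\<chi> i. partial_deriv i (f i) (z t $ i)) + y))
      (at t within {0..})"
    and "(xhat has_vector_derivative k2 *\<^sub>R y) (at t within {0..})"
    and "(z has_vector_derivative - k3 *\<^sub>R consensus_operator E (z t - (\<chi> i. x t)))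
      (at t within {0..})"
proof -
  note T = traj[unfolded closed_loop_trajectory_def Let_def, rule_format, OF t]
  note to_vec = has_real_derivative_iff_has_vector_derivative[symmetric]
  show "(x has_vector_derivative v t) (at t within {0..})"
    by (rule has_vector_derivative_vecI) (use T in \<open>simp add: to_vec\<close>)
  show "(v has_vector_derivative - k1 *\<^sub>R ((\<chi> i. partial_deriv i (f i) (z t $ i)) + y))
      (at t within {0..})"
  proof (rule has_vector_derivative_vecI)
    fix i
    have "(- k1 *\<^sub>R ((\<chi> i. partial_deriv i (f i) (z t $ i)) + y)) $ i
        = - k1 * partial_deriv i (f i) (z t $ i) - k1 * (- (xhat t $ i) + k2 * x t $ i)"
      by (simp add: y_def algebra_simps)
    with T[of i] show "((\<lambda>t. v t $ i) has_vector_derivative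
        (- k1 *\<^sub>R ((\<chi> i. partial_deriv i (f i) (z t $ i)) + y)) $ i) (at t within {0..})"
      by (simp only: to_vec)
  qed
  show "(xhat has_vector_derivative k2 *\<^sub>R y) (at t within {0..})"
  proof (rule has_vector_derivative_vecI)
    fix i
    have "(k2 *\<^sub>R y) $ i = - k2 * xhat t $ i + k2\<^sup>2 * x t $ i"
      by (simp add: y_def power2_eq_square algebra_simps)
    with T[of i] show "((\<lambda>t. xhat t $ i) has_vector_derivative (k2 *\<^sub>R y) $ i) (at t within {0..})"
      by (simp only: to_vec)
  qed
  show "(z has_vector_derivative - k3 *\<^sub>R consensus_operator E (z t - (\<chi> i. x t)))
      (at t within {0..})"
  proof (intro has_vector_derivative_vecI)
    fix i j
    have "(- k3 *\<^sub>R consensus_operator E (z t - (\<chi> i. x t))) $ i $ j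
        = - k3 * ((\<Sum>k\<in>UNIV. adjacency E $ i $ k * (z t $ i $ j - z t $ k $ j))
            + adjacency E $ i $ j * (z t $ i $ j - x t $ j))"
      by (simp add: consensus_operator_def)
    with T[of i] show "((\<lambda>t. z t $ i $ j) has_vector_derivative
        (- k3 *\<^sub>R consensus_operator E (z t - (\<chi> i. x t))) $ i $ j) (at t within {0..})"
      by (simp only: to_vec)
  qed
qed

section \<open>Nash equilibrium seeking\<close>

theorem theorem4:
  fixes f :: "'n::finite \<Rightarrow> real^'n \<Rightarrow> real"
    and E :: "('n \<times> 'n) set"
    and l :: "'n \<Rightarrow> real"
    and m h k1 k2 k3 :: real
    and xstar :: "real^'n"
    and x v xhat :: "real \<Rightarrow> real^'n"
    and z :: "real \<Rightarrow> real^'n^'n"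
  defines "N \<equiv> real CARD('n)"
    and "lmax \<equiv> Max (range l)"
  assumes players: "CARD('n) \<ge> 2"
    and graph: "undirected_graph E" "connected_graph E"
    and smooth: "\<And>i. twice_continuously_differentiable (f i)"
    and monotone: "m > 0"
      "\<And>p q. (p - q) \<bullet> (pseudo_gradient f p - pseudo_gradient f q) \<ge> m * (norm (p - q))\<^sup>2"
    and hessian: "h > 0"
      "bdd_above (range (\<lambda>p. onorm ((*v) (game_hessian f p))))"
      "(SUP p. onorm ((*v) (game_hessian f p))) = h"
    and lipschitz: "\<And>i. (l i)-lipschitz_on UNIV (partial_deriv i (f i))"
    and gains_pos: "k1 > 0" "k2 > 0" "k3 > 0"
    and k1: "k1 > (h * sqrt N * lmax + 1)\<^sup>2 / (4 * m) + h"
    and k2: "k2 > k1"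
    and k3: "k3 > (2 * k1 * lmax + sqrt N + N * lmax)\<^sup>2 /
      (4 * min (min_eigenvalue (gain_matrix m (h * sqrt N * lmax + 1) (k1 - h))) (k2 - k1)
         * min_eigenvalue (kronecker_product (laplacian E) (mat 1 :: real^'n^'n) + adjacency_diag E))"
    and nash: "nash_equilibrium f xstar"
    and trajectory: "closed_loop_trajectory f E k1 k2 k3 x v xhat z"
  shows "((\<lambda>t. norm (x t - xstar)) \<longlongrightarrow> 0) at_top \<and> ((\<lambda>t. norm (v t)) \<longlongrightarrow> 0) at_top"
proof -
  define s where "s = sqrt N"
  have s: "s \<ge> 0" "s\<^sup>2 = N" by (simp_all add: N_def s_def)
  have "0 \<le> l i" for i using lipschitz by (rule lipschitz_on_nonneg)
  moreover have "l i \<le> lmax" for i by (simp add: lmax_def)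
  ultimately have L: "lmax \<ge> 0" by (meson order_trans)
  define P where "P = pseudo_gradient f"
  have P_lip: "norm (P p - P p') \<le> s * lmax * norm (p - p')" for p p'
  proof -
    have "(\<chi> i. p) - (\<chi> i. p') = ((\<chi> i. p - p') :: real^'n^'n)"
      by (simp add: vec_eq_iff)
    then have "norm ((\<chi> i. partial_deriv i (f i) p) - P p') \<le> lmax * (sqrt N * norm (p - p'))"
      using stacked_gradient_lipschitz[OF lipschitz, of "\<chi> i. p" p']
      by (simp add: P_def lmax_def N_def norm_vec_const)
    then show ?thesis by (simp add: P_def pseudo_gradient_def s_def mult_ac)
  qed
  have P_star: "P xstar = 0"
    unfolding P_def by (rule nash_equilibrium_pseudo_gradient_zero[OF smooth nash])
  have H_bound: "norm (game_hessian f p *v u) \<le> h * norm u" for p u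
  proof -
    have "norm (game_hessian f p *v u) \<le> onorm ((*v) (game_hessian f p)) * norm u"
      by (rule onorm) simp
    also have "onorm ((*v) (game_hessian f p)) \<le> h"
      unfolding hessian(3)[symmetric] by (rule cSUP_upper[OF UNIV_I hessian(2)])
    finally show ?thesis by (simp add: mult_right_mono)
  qed

  \<comment> \<open>The bounds on \<open>k1\<close> and \<open>k2\<close> make \<open>\<mu>\<close> positive; the bound on \<open>k3\<close> is then the discriminant
    condition for \<open>c > 0\<close>, and \<open>c\<close> is the decay rate of the four errors.\<close>
  define \<Lambda> where "\<Lambda> = min_eigenvalue (grounded_laplacian E)"
  define \<mu> where
    "\<mu> = min (min_eigenvalue (gain_matrix m (h * s * lmax + 1) (k1 - h))) (k2 - k1)"
  define \<kappa> where "\<kappa> = 2 * k1 * lmax + s + s\<^sup>2 * lmax"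
  define c where "c = min_eigenvalue (gain_matrix \<mu> \<kappa> (k3 * \<Lambda>))"
  have \<Lambda>: "\<Lambda> > 0"
    unfolding \<Lambda>_def
    by (rule min_eigenvalue_pos[OF grounded_laplacian_symmetric[OF graph(1)]
          grounded_laplacian_pos[OF graph players]])
  have "(h * s * lmax + 1)\<^sup>2 < 4 * m * (k1 - h)"
    using k1 monotone(1) by (simp add: s_def field_simps)
  then have \<mu>: "\<mu> > 0"
    using gain_matrix_min_eigenvalue_pos[OF monotone(1)] k2 by (simp add: \<mu>_def)
  have "\<kappa>\<^sup>2 / (4 * \<mu> * \<Lambda>) < k3"
    using k3 unfolding \<kappa>_def \<mu>_def \<Lambda>_def s(2) by (simp add: s_def)
  then have "\<kappa>\<^sup>2 < 4 * \<mu> * (k3 * \<Lambda>)"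
    using \<mu> \<Lambda> by (simp add: field_simps)
  then have c: "c > 0"
    unfolding c_def by (rule gain_matrix_min_eigenvalue_pos[OF \<mu>])

  define e where "e t = x t - xstar" for t
  define w where "w t = v t + P (x t)" for t
  define q where "q t = k2 *\<^sub>R x t - xhat t - v t" for t
  define \<xi> :: "real \<Rightarrow> real^'n^'n" where "\<xi> t = z t - (\<chi> i. x t)" for t
  define g where "g t = (\<chi> i. partial_deriv i (f i) (z t $ i))" for t
  define J where "J t = game_hessian f (x t) *v v t" for t
  define V where "V t = (norm (e t))\<^sup>2 / 2 + (norm (w t))\<^sup>2 / 2 + (norm (q t))\<^sup>2 / 2
    + (norm (\<xi> t))\<^sup>2 / 2" for t
  \<comment> \<open>The derivative of \<open>V\<close> along the trajectory, with \<open>q + v\<close> in the place of \<open>y\<close>.\<close>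
  define V' where "V' t = e t \<bullet> v t + w t \<bullet> (J t - k1 *\<^sub>R (g t + (q t + v t)))
    + q t \<bullet> (k1 *\<^sub>R (g t + (q t + v t)) - k2 *\<^sub>R q t)
    + \<xi> t \<bullet> (- k3 *\<^sub>R consensus_operator E (\<xi> t) - (\<chi> i. v t))" for t

  have V_deriv: "(V has_real_derivative V' t) (at t within {0..})" if t: "t \<ge> 0" for t
  proof -
    note D = closed_loop_trajectory_vector_form[OF trajectory t]
    have y: "k2 *\<^sub>R x t - xhat t = q t + v t" by (simp add: q_def)
    have "(e has_vector_derivative v t) (at t within {0..})"
      unfolding e_def using has_vector_derivative_diff[OF D(1) has_vector_derivative_const] by simp
    moreover have "(w has_vector_derivative J t - k1 *\<^sub>R (g t + (q t + v t))) (at t within {0..})"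
    proof -
      have "((P \<circ> x) has_vector_derivative J t) (at t within {0..})"
        unfolding P_def J_def
        by (rule vector_derivative_diff_chain_within[OF D(1)
              has_derivative_at_withinI[OF pseudo_gradient_has_derivative[OF smooth]]])
      from has_vector_derivative_add[OF D(2) this] show ?thesis
        by (simp add: w_def[abs_def] g_def y)
    qed
    moreover have "(q has_vector_derivative k1 *\<^sub>R (g t + (q t + v t)) - k2 *\<^sub>R q t) (at t within {0..})"
    proof -
      have "((\<lambda>t. k2 *\<^sub>R x t) has_vector_derivative k2 *\<^sub>R v t) (at t within {0..})"
        by (rule bounded_linear.has_vector_derivative[OF bounded_linear_scaleR_right D(1)])
      note has_vector_derivative_diff[OF has_vector_derivative_diff[OF this D(3)] D(2),
          unfolded y, folded g_def q_def]
      moreover have "k2 *\<^sub>R v t - k2 *\<^sub>R (q t + v t) - (- k1 *\<^sub>R (g t + (q t + v t)))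
          = k1 *\<^sub>R (g t + (q t + v t)) - k2 *\<^sub>R q t"
        by (simp add: scaleR_add_right)
      ultimately show ?thesis by simp
    qed
    moreover have "(\<xi> has_vector_derivative - k3 *\<^sub>R consensus_operator E (\<xi> t) - (\<chi> i. v t))
        (at t within {0..})"
      unfolding \<xi>_def
      by (rule has_vector_derivative_diff[OF D(4) stack_has_vector_derivative[OF D(1)]])
    ultimately show ?thesis
      unfolding V_def V'_def by (intro DERIV_add half_squared_norm_derivative)
  qed

  have V_decay: "V' t \<le> - (2 * c) * V t" for t
  proof -
    have "V' t \<le> - (m * (norm (e t))\<^sup>2) + (h * s * lmax + 1) * norm (e t) * norm (w t)
        - (k1 - h) * (norm (w t))\<^sup>2 - (k2 - k1) * (norm (q t))\<^sup>2 - (k3 * \<Lambda>) * (norm (\<xi> t))\<^sup>2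
        + norm (\<xi> t) * (k1 * lmax * norm (w t) + k1 * lmax * norm (q t) + s * norm (w t)
          + s\<^sup>2 * lmax * norm (e t))"
      unfolding V'_def
    proof (rule dissipation_vector[where P = "P (x t)"])
      show "m * (norm (e t))\<^sup>2 \<le> e t \<bullet> P (x t)"
        using monotone(2)[of "x t" xstar] P_star by (simp add: e_def P_def)
      show "norm (P (x t)) \<le> s * lmax * norm (e t)"
        using P_lip[of "x t" xstar] P_star by (simp add: e_def)
      show "norm (g t - P (x t)) \<le> lmax * norm (\<xi> t)"
        unfolding g_def P_def \<xi>_def lmax_def by (rule stacked_gradient_lipschitz[OF lipschitz])
      show "norm (J t) \<le> h * norm (v t)"
        unfolding J_def by (rule H_bound)
      show "\<Lambda> * (norm (\<xi> t))\<^sup>2 \<le> \<xi> t \<bullet> consensus_operator E (\<xi> t)"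
        unfolding \<Lambda>_def by (rule consensus_operator_coercive[OF graph(1)])
      show "norm ((\<chi> i. v t) :: real^'n^'n) = s * norm (v t)"
        unfolding s_def N_def by (rule norm_vec_const)
    qed (use gains_pos hessian(1) L s in \<open>simp_all add: w_def\<close>)
    also have "\<dots> \<le> - c * ((norm (e t))\<^sup>2 + (norm (w t))\<^sup>2 + (norm (q t))\<^sup>2 + (norm (\<xi> t))\<^sup>2)"
      unfolding c_def \<mu>_def \<kappa>_def
      by (rule dissipation_scalar) (use gains_pos L s in auto)
    also have "\<dots> = - (2 * c) * V t" by (simp add: V_def algebra_simps)
    finally show ?thesis .
  qed
  have decay: "V t \<le> V 0 * exp (- (2 * c) * t)" if "t \<ge> 0" for t
    by (rule exponential_decay[OF V_deriv V_decay that])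
  have ew: "((\<lambda>t. norm (e t)) \<longlongrightarrow> 0) at_top" "((\<lambda>t. norm (w t)) \<longlongrightarrow> 0) at_top"
  proof -
    have "(norm (e t))\<^sup>2 \<le> (2 * V 0) * exp (- (2 * c) * t)"
        "(norm (w t))\<^sup>2 \<le> (2 * V 0) * exp (- (2 * c) * t)" if "t \<ge> 0" for t
    proof -
      have "(norm (e t))\<^sup>2 \<le> 2 * V t" "(norm (w t))\<^sup>2 \<le> 2 * V t"
        by (simp_all add: V_def)
      moreover have "2 * V t \<le> (2 * V 0) * exp (- (2 * c) * t)"
        using decay[OF that] by simp
      ultimately show "(norm (e t))\<^sup>2 \<le> (2 * V 0) * exp (- (2 * c) * t)"
          "(norm (w t))\<^sup>2 \<le> (2 * V 0) * exp (- (2 * c) * t)"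
        by - (linarith+)
    qed
    moreover have "2 * c > 0" using c by simp
    ultimately show "((\<lambda>t. norm (e t)) \<longlongrightarrow> 0) at_top" "((\<lambda>t. norm (w t)) \<longlongrightarrow> 0) at_top"
      by - (erule norm_tendsto_zero_if_exponentially_bounded, assumption)+
  qed
  have "((\<lambda>t. norm (v t)) \<longlongrightarrow> 0) at_top"
  proof (rule Lim_null_comparison)
    \<comment> \<open>\<open>v = w - P x\<close> and \<open>P\<close> vanishes at the equilibrium.\<close>
    have "norm (v t) \<le> norm (w t) + s * lmax * norm (e t)" for t
      using norm_triangle_ineq4[of "w t" "P (x t)"] P_lip[of "x t" xstar] P_star
      by (simp add: w_def e_def)
    then show "\<forall>\<^sub>F t in at_top. norm (norm (v t)) \<le> norm (w t) + s * lmax * norm (e t)"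
      by simp
    show "((\<lambda>t. norm (w t) + s * lmax * norm (e t)) \<longlongrightarrow> 0) at_top"
      using tendsto_add[OF ew(2) tendsto_mult_left[OF ew(1)]] by simp
  qed
  with ew(1) show ?thesis by (simp add: e_def)
qed

end
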